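(* Let $p, q\ge 1$ be integers. Then $$Sr(1, p, q) \ =\ 1\quad\text{and}\quad Sr(n+1, p, q) - Sr(n, p, q) \ =\ \left\lfloor\frac{p(n+q+1)}{pq+1}\right\rfloor \quad\text{for all integers } n\ge 1.$$ As a result, for every integer $N\ge 1$, $$Sr(N, p, q)\ =\ 1 + \sum_{n=1}^{N-1}\left\lfloor\frac{p(n+q+1)}{pq+1}\right\rfloor.$$
   Context: Notation: $\mathbb{N}=\{1,2,3,\ldots\}$ and $[n]=\{1,\ldots,n\}$. For $q\ge 1$, let $$\mathcal{A}_q := \{F\subset\mathbb{N}: |F| = 1 \text{ or } F \text{ is an arithmetic progression with difference } q\}.$$ So the (finite, nonempty) members of $\mathcal{A}_q$ contained in $[n]$ are the sets of the form $\{a,a+q,\ldots,a+jq\}\subset[n]$ with $a\ge 1$, $j\ge 0$. For integers $n,p,q\ge 1$, $$Sr(n, p, q) := \#\{F\subset [n] : p\min F\ge |F| \text{ and } F\in \mathcal{A}_q\}.$$ An empty sum equals $0$. *)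

theory Defs
  imports Complex_Main
begin

(* Both finite and infinite progressions are admitted; the infinite ones never lie in [n]. *)
definition arith_prog :: "nat \<Rightarrow> nat set \<Rightarrow> bool" where
  "arith_prog q F \<longleftrightarrow>
     (\<exists>a. (\<exists>j. F = (\<lambda>i. a + i * q) ` {..j}) \<or> F = range (\<lambda>i. a + i * q))"

(* The positive integers are {1..}, so 0 is excluded. *)
definition AP_family :: "nat \<Rightarrow> nat set set" where
  "AP_family q = {F. F \<subseteq> {1..} \<and> (card F = 1 \<or> arith_prog q F)}"

definition Sr :: "nat \<Rightarrow> nat \<Rightarrow> nat \<Rightarrow> nat" where
  "Sr n p q = card {F. F \<subseteq> {1..n} \<and> p * Min F \<ge> card F \<and> F \<in> AP_family q}"

end

theory Submission
  imports Defs
begin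

text \<open>
  Reading a progression backwards from its largest element \<open>m\<close> makes the admissibility condition
  linear in its number \<open>j\<close> of steps.  The progression \<open>m - jq, \<dots>, m - q, m\<close> is admissible iff
  \<open>p (m - jq) \<ge> j + 1\<close>, that is, \<open>(j + 1) (pq + 1) \<le> p (m + q)\<close>.  Hence the admissible
  progressions with maximum \<open>m\<close> are indexed by \<open>0 \<le> j < \<lfloor>p (m + q) / (pq + 1)\<rfloor>\<close>.  The sets
  counted by \<open>Sr (n + 1)\<close> but not by \<open>Sr n\<close> are exactly those with maximum \<open>m = n + 1\<close>, which
  gives the recurrence.

  The recurrence also holds at \<open>n = 0\<close>, where it reads
  \<open>Sr 1 - Sr 0 = \<lfloor>p (q + 1) / (pq + 1)\<rfloor> = 1\<close>, and \<open>Sr 0 = 0\<close>; so the initial value comes out of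
  the same count, and the summation formula follows by telescoping.
\<close>

definition descending_ap :: "nat \<Rightarrow> nat \<Rightarrow> nat \<Rightarrow> nat set" where
  "descending_ap q m j = (\<lambda>i. m - i * q) ` {..j}"

lemma descending_ap_altdef:
  assumes "j * q < m"
  shows "descending_ap q m j = (\<lambda>i. (m - j * q) + i * q) ` {..j}"
proof -
  have flip: "m - i * q = (m - j * q) + (j - i) * q" if "i \<le> j" for i
    using that assms mult_le_mono1[OF that, of q] by (simp add: diff_mult_distrib)
  have "descending_ap q m j = (\<lambda>i. (m - j * q) + i * q) ` (\<lambda>i. j - i) ` {..j}"
    unfolding descending_ap_def image_image by (intro image_cong refl flip) simp
  also have "(\<lambda>i. j - i) ` {..j} = {..j}"
  proof (intro equalityI subsetI)
    fix i assume "i \<in> {..j}"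
    then show "i \<in> (\<lambda>i. j - i) ` {..j}"
      by (intro image_eqI[of _ _ "j - i"]) auto
  qed auto
  finally show ?thesis .
qed

lemma finite_descending_ap [simp]: "finite (descending_ap q m j)"
  by (simp add: descending_ap_def)

lemma card_descending_ap:
  assumes "q \<ge> 1" "j * q < m"
  shows "card (descending_ap q m j) = Suc j"
  unfolding descending_ap_altdef[OF assms(2)]
  using assms(1) by (subst card_image) (auto simp: inj_on_def)

lemma Max_descending_ap: "Max (descending_ap q m j) = m"
proof (rule Max_eqI)
  show "m \<in> descending_ap q m j"
    unfolding descending_ap_def by (rule image_eqI[of _ _ 0]) auto
qed (auto simp: descending_ap_def)

lemma Min_descending_ap:
  assumes "j * q < m"
  shows "Min (descending_ap q m j) = m - j * q"
  unfolding descending_ap_def by (rule Min_eqI) (auto intro: diff_le_mono2)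

lemma descending_ap_in_AP_family:
  assumes "j * q < m"
  shows "descending_ap q m j \<in> AP_family q"
proof -
  have "descending_ap q m j \<subseteq> {1..}"
    unfolding descending_ap_altdef[OF assms] using assms by auto
  moreover have "arith_prog q (descending_ap q m j)"
    unfolding descending_ap_altdef[OF assms] arith_prog_def by blast
  ultimately show ?thesis
    unfolding AP_family_def by blast
qed

text \<open>
  A bound on \<open>F\<close> rules out infinite progressions because \<open>q \<ge> 1\<close>, and a singleton is the
  progression with no steps.
\<close>

lemma bounded_AP_is_descending_ap:
  assumes "q \<ge> 1" "F \<subseteq> {1..n}" "F \<in> AP_family q"
  obtains m j where "j * q < m" "F = descending_ap q m j"
proof -
  have pos: "x > 0" if "x \<in> F" for x
    using assms(2) that by auto
  have inf: "infinite (range (\<lambda>i. a + i * q))" for a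
    using assms(1) by (subst finite_image_iff) (auto simp: inj_on_def)
  have "finite F"
    using assms(2) by (rule finite_subset) simp
  with assms(3) inf consider
      (single) "card F = 1" | (prog) a j where "F = (\<lambda>i. a + i * q) ` {..j}"
    unfolding AP_family_def arith_prog_def by blast
  then show thesis
  proof cases
    case single
    then obtain m where F: "F = {m}"
      by (auto simp: card_Suc_eq)
    show thesis
      by (rule that[of 0 m]) (use F pos in \<open>auto simp: descending_ap_def\<close>)
  next
    case (prog a j)
    have "a + 0 * q \<in> F"
      unfolding prog by blast
    then have "a > 0"
      using pos by fastforce
    then show thesis
      using prog by (intro that[of j "a + j * q"]) (auto simp: descending_ap_altdef)
  qed
qed

definition admissible :: "nat \<Rightarrow> nat \<Rightarrow> nat \<Rightarrow> nat set set" where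
  "admissible n p q = {F. F \<subseteq> {1..n} \<and> p * Min F \<ge> card F \<and> F \<in> AP_family q}"

lemma Sr_eq_card_admissible: "Sr n p q = card (admissible n p q)"
  by (simp add: Sr_def admissible_def)

lemma finite_admissible: "finite (admissible n p q)"
  by (rule finite_subset[of _ "Pow {1..n}"]) (auto simp: admissible_def)

text \<open>
  Adding \<open>(j + 1) p q\<close> to both sides of \<open>j + 1 \<le> p (m - j q)\<close> gives \<open>(j + 1) (p q + 1) \<le> p (m + q)\<close>.
  This survives truncated subtraction: if \<open>j q > m\<close>, the product on the left is \<open>0\<close>, and
  \<open>p (m + q) \<le> (j + 1) p q\<close>, so both inequalities fail.
\<close>

lemma admissible_steps_iff:
  fixes p q m j :: nat
  shows "Suc j \<le> p * (m - j * q) \<longleftrightarrow> j < (p * (m + q)) div (p * q + 1)"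
proof (cases "j * q \<le> m")
  case True
  then obtain d where m: "m = j * q + d"
    using le_Suc_ex by blast
  have "j < (p * (m + q)) div (p * q + 1) \<longleftrightarrow> Suc j * (p * q + 1) \<le> p * (m + q)"
    by (subst less_eq_div_iff_mult_less_eq[symmetric]) auto
  also have "\<dots> \<longleftrightarrow> Suc j \<le> p * d"
    by (simp add: m algebra_simps)
  finally show ?thesis
    by (simp add: m)
next
  case False
  then have "p * (m + q) \<le> p * (Suc j * q)"
    by (intro mult_le_mono) auto
  also have "\<dots> < Suc j * (p * q + 1)"
    by (simp add: algebra_simps)
  finally have "p * (m + q) < Suc j * (p * q + 1)" .
  then have "(p * (m + q)) div (p * q + 1) < Suc j"
    by (subst div_less_iff_less_mult) auto
  then show ?thesis
    using False by simp
qed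

lemma admissible_diff:
  assumes "q \<ge> 1"
  shows "admissible (Suc n) p q - admissible n p q
       = descending_ap q (Suc n) ` {..<(p * (Suc n + q)) div (p * q + 1)}" (is "?L = ?R")
proof (intro equalityI subsetI)
  fix F assume F: "F \<in> ?L"
  then have sub: "F \<subseteq> {1..Suc n}" and ap: "F \<in> AP_family q" and adm: "card F \<le> p * Min F"
    and notsub: "\<not> F \<subseteq> {1..n}"
    by (auto simp: admissible_def)
  obtain m j where jm: "j * q < m" and Fmj: "F = descending_ap q m j"
    using bounded_AP_is_descending_ap[OF assms sub ap] .
  have "Suc n \<in> F"
    using sub notsub by (force simp: le_Suc_eq)
  then have "Max F = Suc n"
    using sub finite_subset[OF sub] by (intro Max_eqI) auto
  then have m: "m = Suc n"
    by (simp add: Fmj Max_descending_ap)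
  have "Suc j \<le> p * (m - j * q)"
    using adm assms jm by (simp add: Fmj card_descending_ap Min_descending_ap)
  then have "j < (p * (Suc n + q)) div (p * q + 1)"
    unfolding admissible_steps_iff m .
  then show "F \<in> ?R"
    unfolding Fmj m by (intro imageI) simp
next
  fix F assume "F \<in> ?R"
  then obtain j where Fj: "F = descending_ap q (Suc n) j"
    and "j < (p * (Suc n + q)) div (p * q + 1)"
    by auto
  then have j: "Suc j \<le> p * (Suc n - j * q)"
    unfolding admissible_steps_iff by simp
  then have "Suc n - j * q \<noteq> 0"
    by (intro notI) simp
  then have jm: "j * q < Suc n"
    by simp
  have ap: "F \<in> AP_family q"
    unfolding Fj using jm by (rule descending_ap_in_AP_family)
  then have "F \<subseteq> {1..Suc n}"
    by (auto simp: AP_family_def Fj descending_ap_def)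
  moreover have "Suc n - 0 * q \<in> F"
    unfolding Fj descending_ap_def by blast
  then have "\<not> F \<subseteq> {1..n}"
    by auto
  moreover have "card F \<le> p * Min F"
    using j jm assms by (simp add: Fj card_descending_ap Min_descending_ap)
  ultimately show "F \<in> ?L"
    using ap by (simp add: admissible_def)
qed

lemma Sr_Suc:
  assumes "q \<ge> 1"
  shows "Sr (Suc n) p q = Sr n p q + (p * (Suc n + q)) div (p * q + 1)"
proof -
  let ?K = "(p * (Suc n + q)) div (p * q + 1)"
  have "inj_on (descending_ap q (Suc n)) {..<?K}"
  proof (rule inj_onI)
    fix i j assume ij: "i \<in> {..<?K}" "j \<in> {..<?K}"
      and eq: "descending_ap q (Suc n) i = descending_ap q (Suc n) j"
    have "k * q < Suc n" if "k \<in> {..<?K}" for k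
    proof -
      have "Suc k \<le> p * (Suc n - k * q)"
        using that unfolding admissible_steps_iff by simp
      then have "Suc n - k * q \<noteq> 0"
        by (intro notI) simp
      then show ?thesis
        by simp
    qed
    with ij have "Suc i = Suc j"
      using arg_cong[OF eq, of card] assms by (simp add: card_descending_ap)
    then show "i = j"
      by simp
  qed
  then have new: "card (admissible (Suc n) p q - admissible n p q) = ?K"
    unfolding admissible_diff[OF assms] by (simp add: card_image)
  have sub: "admissible n p q \<subseteq> admissible (Suc n) p q"
    by (auto simp: admissible_def)
  have "card (admissible (Suc n) p q)
      = card (admissible n p q) + card (admissible (Suc n) p q - admissible n p q)"
    using card_Diff_subset[OF finite_admissible sub] card_mono[OF finite_admissible sub] by simp
  then show ?thesis
    by (simp only: new Sr_eq_card_admissible)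
qed

lemma Sr_0: "Sr 0 p q = 0"
  by (auto simp: Sr_def AP_family_def arith_prog_def)

lemma Sr_1:
  assumes "p \<ge> 1" "q \<ge> 1"
  shows "Sr 1 p q = 1"
proof -
  obtain r where "q = Suc r"
    using assms(2) by (cases q) auto
  then have "(p * (Suc 0 + q)) div (p * q + 1) = 1"
    using assms(1) by (intro div_nat_eqI) (auto simp: algebra_simps)
  then show ?thesis
    using Sr_Suc[OF assms(2), of 0 p] by (simp add: Sr_0)
qed

theorem theorem1p4:
  fixes p q :: nat
  assumes "p \<ge> 1" and "q \<ge> 1"
  shows "Sr 1 p q = 1
    \<and> (\<forall>n\<ge>1. int (Sr (n + 1) p q) - int (Sr n p q)
          = \<lfloor>(real p * (real n + real q + 1)) / (real p * real q + 1)\<rfloor>)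
    \<and> (\<forall>N\<ge>1. int (Sr N p q)
          = 1 + (\<Sum>n = 1..N - 1. \<lfloor>(real p * (real n + real q + 1)) / (real p * real q + 1)\<rfloor>))"
proof -
  let ?f = "\<lambda>n. \<lfloor>(real p * (real n + real q + 1)) / (real p * real q + 1)\<rfloor>"
  have "?f n = int ((p * (Suc n + q)) div (p * q + 1))" for n
  proof -
    have "?f n = \<lfloor>real (p * (Suc n + q)) / real (p * q + 1)\<rfloor>"
      by (simp add: algebra_simps)
    then show ?thesis
      by (simp only: floor_divide_of_nat_eq)
  qed
  then have step: "int (Sr (n + 1) p q) - int (Sr n p q) = ?f n" for n
    by (simp add: Sr_Suc[OF assms(2)])
  have sum: "int (Sr (Suc k) p q) = 1 + (\<Sum>n = 1..k. ?f n)" for k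
  proof (induction k)
    case 0
    show ?case
      using Sr_1[OF assms] by simp
  next
    case (Suc k)
    then show ?case
      using step[of "Suc k"] by simp
  qed
  have "int (Sr N p q) = 1 + (\<Sum>n = 1..N - 1. ?f n)" if "N \<ge> 1" for N
    using sum[of "N - 1"] that by simp
  with Sr_1[OF assms] step show ?thesis
    by blast
qed

end
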